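(* Let $(X,\widehat d_X)$ and $(Y,\widehat d_Y)$ be two non-Archimedean metric spaces such that every ball in $X$ and every ball in $Y$ contains at least two distinct elements. (1) For every $\lambda>0$, the functions $\widehat\beta_{X,Y}^{\lambda}$ and $\widehat\beta_{X,Y}^{\ast\lambda}$ are non-Archimedean metrics on $\mathfrak D_\flat(X,Y)$. (2) For any $\lambda>0$ and $P_1,P_2\in\mathfrak D_\flat(X,Y)$, $$\widehat\beta_{X,Y}^{\ast\lambda}(P_1,P_2)\le\widehat\rho_s(P_1,P_2)\le\widehat\beta_{X,Y}^{\lambda}(P_1,P_2),\qquad \widehat\rho_H(P_1,P_2)\le\max\{1,\lambda\}\cdot\widehat\beta_{X,Y}^{\ast\lambda}(P_1,P_2).$$ In particular, if $P_1,P_2\in\mathfrak D_\flat^{(1)}(X,Y)$, then $$\widehat\rho_H(P_1,P_2)=\widehat\rho_s(P_1,P_2)=\widehat\beta_{X,Y}(P_1,P_2)=\widehat\beta_{X,Y}^{\ast}(P_1,P_2).$$ (3) For $P\in\mathfrak D_\flat^{(1)}(X,Y)$ and a sequence $\{P_n\}_{n=1}^\infty$ in $\mathfrak D_\flat(X,Y)$, the following are equivalent: (A) $\widehat\beta_{X,Y}(P_n,P)\to0$ as $n\to\infty$; (B) $\sup_{B\in\mathcal M_\flat(X)}\widehat d_Y(P_n(B),P(B))\to0$ as $n\to\infty$, i.e. $P_n$ converges uniformly to $P$.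
   Context: Metrics may take the value $+\infty$, and $\inf\emptyset=+\infty$. A metric $\widehat d$ is non-Archimedean if $\widehat d(x,z)\le\max\{\widehat d(x,y),\widehat d(y,z)\}$. A ball in $X$ is a set $\{x:\widehat d_X(a,x)<r\}$ or $\{x:\widehat d_X(a,x)\le r\}$ with $a\in X$, $0<r<\infty$. $\mathcal M_\flat(X)$ is the set of all balls in $X$, a non-Archimedean metric space under the Hausdorff distance $\widehat d_{X,H}$, where $d_H(A,B)=\max\{\sup_{a\in A}\operatorname{dist}(a,B),\sup_{b\in B}\operatorname{dist}(b,A)\}$ and $\operatorname{dist}(x,A)=\inf_{a\in A}d(x,a)$. For $B\in\mathcal M_\flat(X)$ and $\varepsilon>0$, $B^{\varepsilon}=\{x\in X:\operatorname{dist}(x,B)<\varepsilon\}$, which is again a ball in $X$. $\mathfrak D_\flat(X,Y)$ is the set of all maps $P:\mathcal M_\flat(X)\to Y$. For $P_1,P_2\in\mathfrak D_\flat(X,Y)$: - $\widehat\rho_s(P_1,P_2)=\sup_{B\in\mathcal M_\flat(X)}\widehat d_Y(P_1(B),P_2(B))$. - $\widehat\rho_H(P_1,P_2)$ is the Hausdorff distance between the graphs $\Gamma_{P_i}=\{(B,P_i(B)):B\in\mathcal M_\flat(X)\}$ in $\mathcal M_\flat(X)\times Y$ with the metric $\max\{\widehat d_{X,H},\widehat d_Y\}$. - For $\lambda>0$ and $P_1\ne P_2$, $\widehat\beta_{X,Y}^{\lambda}(P_1,P_2)$ is the infimum of all $\varepsilon>0$ such that $\widehat d_Y(P_1(B),P_2(B^{\lambda\varepsilon}))\le\varepsilon$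 and $\widehat d_Y(P_2(B),P_1(B^{\lambda\varepsilon}))\le\varepsilon$ for all $B\in\mathcal M_\flat(X)$; $\widehat\beta_{X,Y}^{\lambda}(P,P)=0$. - For $\lambda>0$, $\widehat\beta_{X,Y}^{\ast\lambda}(P_1,P_2)$ is the infimum of all $\varepsilon>0$ such that for every $B\in\mathcal M_\flat(X)$ there exist positive numbers $\varepsilon_B,\varepsilon_B'\le\varepsilon$ with $\widehat d_Y(P_1(B),P_2(B^{\lambda\varepsilon_B}))\le\varepsilon$ and $\widehat d_Y(P_2(B),P_1(B^{\lambda\varepsilon_B'}))\le\varepsilon$. - $\widehat\beta_{X,Y}=\widehat\beta_{X,Y}^{1}$ and $\widehat\beta_{X,Y}^{\ast}=\widehat\beta_{X,Y}^{\ast1}$. $\mathfrak D_\flat^{(\lambda)}(X,Y)$ is the set of $P\in\mathfrak D_\flat(X,Y)$ with $\widehat d_Y(P(B),P(B^{\lambda\varepsilon}))\le\varepsilon$ for all $\varepsilon>0$ and all $B\in\mathcal M_\flat(X)$. *)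

theory Defs
  imports "HOL-Library.Extended_Nonnegative_Real" "HOL-Library.FuncSet"
begin

text \<open>
  Metrics may take the value \<open>\<infinity>\<close>, so distances live in \<^typ>\<open>ennreal\<close>, where the infimum of
  the empty set is \<open>\<infinity>\<close> and the supremum of the empty set is \<open>0\<close>.  Spaces are given by a
  carrier set together with a distance function constrained only on the carrier.  Radii and the
  parameters \<open>\<epsilon>\<close> and \<open>l\<close> (the paper's lambda, a reserved symbol here) are real, hence finite.
\<close>

definition nonarch_metric :: "'a set \<Rightarrow> ('a \<Rightarrow> 'a \<Rightarrow> ennreal) \<Rightarrow> bool" where
  "nonarch_metric X d \<longleftrightarrow>
     (\<forall>x\<in>X. \<forall>y\<in>X. d x y = 0 \<longleftrightarrow> x = y) \<and>
     (\<forall>x\<in>X. \<forall>y\<in>X. d x y = d y x) \<and>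
     (\<forall>x\<in>X. \<forall>y\<in>X. \<forall>z\<in>X. d x z \<le> max (d x y) (d y z))"

definition balls :: "'a set \<Rightarrow> ('a \<Rightarrow> 'a \<Rightarrow> ennreal) \<Rightarrow> 'a set set" where
  "balls X d = {B. \<exists>a\<in>X. \<exists>r::real. 0 < r \<and>
     (B = {x\<in>X. d a x < ennreal r} \<or> B = {x\<in>X. d a x \<le> ennreal r})}"

definition dist_to_set :: "('a \<Rightarrow> 'a \<Rightarrow> ennreal) \<Rightarrow> 'a \<Rightarrow> 'a set \<Rightarrow> ennreal" where
  "dist_to_set d x A = (INF a\<in>A. d x a)"

definition hausdorff_dist :: "('a \<Rightarrow> 'a \<Rightarrow> ennreal) \<Rightarrow> 'a set \<Rightarrow> 'a set \<Rightarrow> ennreal" where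
  "hausdorff_dist d A B = max (SUP a\<in>A. dist_to_set d a B) (SUP b\<in>B. dist_to_set d b A)"

definition nbhd :: "'a set \<Rightarrow> ('a \<Rightarrow> 'a \<Rightarrow> ennreal) \<Rightarrow> 'a set \<Rightarrow> real \<Rightarrow> 'a set" where
  "nbhd X d B \<epsilon> = {x\<in>X. dist_to_set d x B < ennreal \<epsilon>}"

text \<open>
  A map defined only on the balls of \<open>X\<close> is represented by its extensional representative, so that
  equality of HOL functions is equality of maps.
\<close>

definition ball_maps :: "'a set \<Rightarrow> ('a \<Rightarrow> 'a \<Rightarrow> ennreal) \<Rightarrow> 'b set \<Rightarrow> ('a set \<Rightarrow> 'b) set" where
  "ball_maps X dX Y = (balls X dX \<rightarrow>\<^sub>E Y)"

definition rho_s :: "'a set \<Rightarrow> ('a \<Rightarrow> 'a \<Rightarrow> ennreal) \<Rightarrow> ('b \<Rightarrow> 'b \<Rightarrow> ennreal) \<Rightarrow>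
    ('a set \<Rightarrow> 'b) \<Rightarrow> ('a set \<Rightarrow> 'b) \<Rightarrow> ennreal" where
  "rho_s X dX dY P1 P2 = (SUP B\<in>balls X dX. dY (P1 B) (P2 B))"

definition ball_graph :: "'a set \<Rightarrow> ('a \<Rightarrow> 'a \<Rightarrow> ennreal) \<Rightarrow> ('a set \<Rightarrow> 'b) \<Rightarrow> ('a set \<times> 'b) set" where
  "ball_graph X dX P = {(B, P B) | B. B \<in> balls X dX}"

definition max_dist :: "('c \<Rightarrow> 'c \<Rightarrow> ennreal) \<Rightarrow> ('b \<Rightarrow> 'b \<Rightarrow> ennreal) \<Rightarrow>
    'c \<times> 'b \<Rightarrow> 'c \<times> 'b \<Rightarrow> ennreal" where
  "max_dist d1 d2 p q = max (d1 (fst p) (fst q)) (d2 (snd p) (snd q))"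

definition rho_H :: "'a set \<Rightarrow> ('a \<Rightarrow> 'a \<Rightarrow> ennreal) \<Rightarrow> ('b \<Rightarrow> 'b \<Rightarrow> ennreal) \<Rightarrow>
    ('a set \<Rightarrow> 'b) \<Rightarrow> ('a set \<Rightarrow> 'b) \<Rightarrow> ennreal" where
  "rho_H X dX dY P1 P2 =
     hausdorff_dist (max_dist (hausdorff_dist dX) dY) (ball_graph X dX P1) (ball_graph X dX P2)"

definition beta :: "real \<Rightarrow> 'a set \<Rightarrow> ('a \<Rightarrow> 'a \<Rightarrow> ennreal) \<Rightarrow> ('b \<Rightarrow> 'b \<Rightarrow> ennreal) \<Rightarrow>
    ('a set \<Rightarrow> 'b) \<Rightarrow> ('a set \<Rightarrow> 'b) \<Rightarrow> ennreal" where
  "beta l X dX dY P1 P2 = (if P1 = P2 then 0 else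
     Inf {ennreal \<epsilon> | \<epsilon>. 0 < \<epsilon> \<and> (\<forall>B\<in>balls X dX.
       dY (P1 B) (P2 (nbhd X dX B (l * \<epsilon>))) \<le> ennreal \<epsilon> \<and>
       dY (P2 B) (P1 (nbhd X dX B (l * \<epsilon>))) \<le> ennreal \<epsilon>)})"

definition beta_star :: "real \<Rightarrow> 'a set \<Rightarrow> ('a \<Rightarrow> 'a \<Rightarrow> ennreal) \<Rightarrow> ('b \<Rightarrow> 'b \<Rightarrow> ennreal) \<Rightarrow>
    ('a set \<Rightarrow> 'b) \<Rightarrow> ('a set \<Rightarrow> 'b) \<Rightarrow> ennreal" where
  "beta_star l X dX dY P1 P2 =
     Inf {ennreal \<epsilon> | \<epsilon>. 0 < \<epsilon> \<and> (\<forall>B\<in>balls X dX. \<exists>\<epsilon>1 \<epsilon>2.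
       0 < \<epsilon>1 \<and> \<epsilon>1 \<le> \<epsilon> \<and> 0 < \<epsilon>2 \<and> \<epsilon>2 \<le> \<epsilon> \<and>
       dY (P1 B) (P2 (nbhd X dX B (l * \<epsilon>1))) \<le> ennreal \<epsilon> \<and>
       dY (P2 B) (P1 (nbhd X dX B (l * \<epsilon>2))) \<le> ennreal \<epsilon>)}"

definition lip_ball_maps :: "real \<Rightarrow> 'a set \<Rightarrow> ('a \<Rightarrow> 'a \<Rightarrow> ennreal) \<Rightarrow> 'b set \<Rightarrow>
    ('b \<Rightarrow> 'b \<Rightarrow> ennreal) \<Rightarrow> ('a set \<Rightarrow> 'b) set" where
  "lip_ball_maps l X dX Y dY = {P \<in> ball_maps X dX Y. \<forall>\<epsilon>>0. \<forall>B\<in>balls X dX.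
     dY (P B) (P (nbhd X dX B (l * \<epsilon>))) \<le> ennreal \<epsilon>}"

end

theory Submission
  imports Defs
begin

text \<open>
  Two facts about non-Archimedean balls drive everything.  Since a ball \<open>B\<close> has a positive radius
  \<open>r\<close>, fattening it by at most \<open>r\<close> changes nothing, and fattening it by more gives the open ball
  with the same centre and the larger radius (lemma \<open>nbhd_ball_cases\<close>).  And successive fattenings
  absorb each other, \<open>(B\<^sup>\<delta>)\<^sup>\<epsilon> = B\<^sup>m\<close> with \<open>m = max \<delta> \<epsilon>\<close> (lemma \<open>nbhd_nbhd\<close>).

  The first fact gives separation: when the parameter tends to \<open>0\<close> with \<open>B\<close> fixed, the fattened
  ball is eventually \<open>B\<close> itself, so a vanishing distance forces \<open>P1 B = P2 B\<close>.  It also gives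
  \<open>\<beta>\<^sup>* \<le> \<rho>\<^sub>s\<close>, because \<open>\<beta>\<^sup>*\<close> lets the parameter depend on \<open>B\<close>.  The second fact gives the
  strong triangle inequality: chaining admissible parameters \<open>e\<close> and \<open>f\<close> makes \<open>max e f\<close>
  admissible.

  Absorption also yields \<open>\<rho>\<^sub>s \<le> \<beta>\<close>.  The ball \<open>C = B\<^sup>l\<^sup>\<epsilon>\<close> satisfies \<open>C\<^sup>l\<^sup>\<epsilon> = C\<close>, hence each of the
  consecutive pairs in \<open>P1 B, P2 C, P1 C, P2 B\<close> is at distance at most \<open>\<epsilon>\<close>.  The bound on \<open>\<rho>\<^sub>H\<close>
  holds because \<open>B\<close> and \<open>B\<^sup>\<delta>\<close> are within Hausdorff distance \<open>\<delta>\<close>.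

  For maps that are \<open>1\<close>-Lipschitz along fattenings the chain \<open>\<rho>\<^sub>H \<le> \<beta>\<^sup>* \<le> \<rho>\<^sub>s \<le> \<beta>\<close> closes up,
  since balls at Hausdorff distance less than \<open>\<epsilon>\<close> have the same \<open>\<epsilon>\<close>-fattening
  (lemma \<open>nbhd_eq_if_hausdorff_less\<close>), so that a graph point of the other map near \<open>(B, P1 B)\<close> can
  be moved to the ball \<open>B\<^sup>\<epsilon>\<close>.  For the comparison of \<open>\<beta>\<close> with \<open>\<rho>\<^sub>s\<close> alone it is enough that one
  of the two maps is Lipschitz; thus \<open>\<beta> = \<rho>\<^sub>s\<close> along a sequence with Lipschitz limit, which is the
  convergence criterion.
\<close>

section \<open>Infima of admissible real parameters\<close>

definition adm_inf :: "(real \<Rightarrow> bool) \<Rightarrow> ennreal" where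
  "adm_inf p = Inf {ennreal e | e. 0 < e \<and> p e}"

lemma adm_inf_le: "0 < e \<Longrightarrow> p e \<Longrightarrow> adm_inf p \<le> ennreal e"
  unfolding adm_inf_def by (rule Inf_lower) auto

lemma adm_inf_geI: "(\<And>e. 0 < e \<Longrightarrow> p e \<Longrightarrow> a \<le> ennreal e) \<Longrightarrow> a \<le> adm_inf p"
  unfolding adm_inf_def by (rule Inf_greatest) auto

lemma adm_inf_lessE:
  assumes "adm_inf p < a"
  obtains e where "0 < e" "p e" "ennreal e < a"
  using assms unfolding adm_inf_def Inf_less_iff by blast

text \<open>
  Distances may be infinite, but a comparison can still be tested against real numbers, because
  every gap between two extended values contains one.
\<close>

lemma ennreal_le_if_real_bounds:
  fixes a b :: ennreal
  assumes "\<And>e::real. 0 < e \<Longrightarrow> b < ennreal e \<Longrightarrow> a \<le> ennreal e"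
  shows "a \<le> b"
proof (rule ccontr)
  assume "\<not> a \<le> b"
  then have "b < a"
    by simp
  then obtain c where c: "b < c" "c < a"
    by (rule dense[THEN exE]) blast
  have fin: "c < top"
    using c(2) by (rule less_le_trans) simp
  have "c \<noteq> 0"
    using c(1) by auto
  then have "0 < enn2real c" "ennreal (enn2real c) = c"
    using fin by (simp_all add: enn2real_positive_iff zero_less_iff_neq_zero)
  then show False
    using assms[of "enn2real c"] c by auto
qed

lemma adm_inf_triangle:
  assumes "\<And>e f. 0 < e \<Longrightarrow> p e \<Longrightarrow> 0 < f \<Longrightarrow> q f \<Longrightarrow> s (max e f)"
  shows "adm_inf s \<le> max (adm_inf p) (adm_inf q)"
proof (rule ennreal_le_if_real_bounds)
  fix c :: real
  assume "max (adm_inf p) (adm_inf q) < ennreal c"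
  then have "adm_inf p < ennreal c" "adm_inf q < ennreal c"
    by simp_all
  then obtain e f where ef: "0 < e" "p e" "ennreal e < ennreal c" "0 < f" "q f" "ennreal f < ennreal c"
    by (elim adm_inf_lessE)
  have "adm_inf s \<le> ennreal (max e f)"
    using ef assms by (intro adm_inf_le) auto
  also have "\<dots> \<le> ennreal c"
    using ef by (auto simp: max_def)
  finally show "adm_inf s \<le> ennreal c" .
qed

section \<open>Fattenings of non-Archimedean balls\<close>

lemma nonarch_refl: "nonarch_metric X d \<Longrightarrow> x \<in> X \<Longrightarrow> d x x = 0"
  by (simp add: nonarch_metric_def)

lemma nonarch_sym: "nonarch_metric X d \<Longrightarrow> x \<in> X \<Longrightarrow> y \<in> X \<Longrightarrow> d x y = d y x"
  by (simp add: nonarch_metric_def)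

lemma nonarch_triangle:
  "nonarch_metric X d \<Longrightarrow> x \<in> X \<Longrightarrow> y \<in> X \<Longrightarrow> z \<in> X \<Longrightarrow> d x z \<le> max (d x y) (d y z)"
  by (simp add: nonarch_metric_def)

lemma nonarch_le:
  assumes "nonarch_metric X d" "x \<in> X" "y \<in> X" "z \<in> X" "d x y \<le> c" "d y z \<le> c"
  shows "d x z \<le> c"
  using nonarch_triangle[OF assms(1-4)] max.boundedI[OF assms(5,6)] by (rule order_trans)

lemma nonarch_less:
  assumes "nonarch_metric X d" "x \<in> X" "y \<in> X" "z \<in> X" "d x y < c" "d y z < c"
  shows "d x z < c"
  using nonarch_triangle[OF assms(1-4)] assms(5,6) by (simp add: le_less_trans)

lemma ball_subset: "B \<in> balls X d \<Longrightarrow> B \<subseteq> X"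
  by (auto simp: balls_def)

lemma dist_to_set_less_iff: "dist_to_set d x A < c \<longleftrightarrow> (\<exists>a\<in>A. d x a < c)"
  by (simp add: dist_to_set_def INF_less_iff)

lemma mem_nbhd_iff: "x \<in> nbhd X d B e \<longleftrightarrow> x \<in> X \<and> (\<exists>b\<in>B. d x b < ennreal e)"
  by (simp add: nbhd_def dist_to_set_less_iff)

lemma subset_nbhd:
  assumes "nonarch_metric X d" "B \<subseteq> X" "0 < e"
  shows "B \<subseteq> nbhd X d B e"
proof
  fix x assume x: "x \<in> B"
  then have "x \<in> X"
    using assms(2) by (rule subsetD[rotated])
  with x show "x \<in> nbhd X d B e"
    using assms(3) by (auto simp: mem_nbhd_iff nonarch_refl[OF assms(1)] intro!: bexI[of _ x])
qed

text \<open>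
  A chain of two steps of lengths below \<open>e\<close> and \<open>f\<close> is, by the strong triangle inequality, one step
  of length below the larger bound; conversely one of the two steps may be left out.
\<close>

lemma nbhd_nbhd:
  assumes X: "nonarch_metric X d" and B: "B \<subseteq> X" and e: "0 < e" and f: "0 < f"
  shows "nbhd X d (nbhd X d B e) f = nbhd X d B (max e f)"
proof
  show "nbhd X d (nbhd X d B e) f \<subseteq> nbhd X d B (max e f)"
  proof
    fix x assume "x \<in> nbhd X d (nbhd X d B e) f"
    then obtain y b where y: "x \<in> X" "y \<in> X" "b \<in> B" "d x y < ennreal f" "d y b < ennreal e"
      by (auto simp: mem_nbhd_iff)
    have "ennreal f \<le> ennreal (max e f)" "ennreal e \<le> ennreal (max e f)"
      by (simp_all add: ennreal_leI)
    then have "d x y < ennreal (max e f)" "d y b < ennreal (max e f)"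
      using y(4,5) by (auto elim: less_le_trans)
    then have "d x b < ennreal (max e f)"
      using nonarch_less[OF X y(1,2) subsetD[OF B y(3)]] by simp
    then show "x \<in> nbhd X d B (max e f)"
      using y unfolding mem_nbhd_iff by blast
  qed
next
  have sub: "nbhd X d B e \<subseteq> X"
    by (auto simp: mem_nbhd_iff)
  have BN: "B \<subseteq> nbhd X d B e"
    using subset_nbhd[OF X B e] .
  show "nbhd X d B (max e f) \<subseteq> nbhd X d (nbhd X d B e) f"
  proof (cases "e \<le> f")
    case True
    then show ?thesis
      using BN by (auto simp: max_def mem_nbhd_iff[of _ _ _ "nbhd X d B e"] mem_nbhd_iff[of _ _ _ B f]
          intro: bexI[OF _ subsetD[OF BN]])
  next
    case False
    then show ?thesis
      using subset_nbhd[OF X sub f] by (simp add: max_def)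
  qed
qed

text \<open>
  Two points of a ball of radius \<open>r\<close> are within \<open>r\<close> of each other, so a step shorter than \<open>r\<close> never
  leaves the ball, while for a longer step all points of the ball serve equally well as its centre.
\<close>

lemma nbhd_ball_cases:
  assumes X: "nonarch_metric X d" and B: "B \<in> balls X d"
  shows "\<exists>c\<in>X. \<exists>r>0. (\<forall>e>0. e \<le> r \<longrightarrow> nbhd X d B e = B) \<and>
    (\<forall>e>r. nbhd X d B e = {x\<in>X. d c x < ennreal e})"
proof -
  from B obtain c r where c: "c \<in> X" "0 < r"
    and B_cases: "B = {x\<in>X. d c x < ennreal r} \<or> B = {x\<in>X. d c x \<le> ennreal r}"
    unfolding balls_def by blast
  have BX: "B \<subseteq> X" and cB: "c \<in> B"
    using B_cases c nonarch_refl[OF X c(1)] by auto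
  have small: "nbhd X d B e = B" if e: "0 < e" "e \<le> r" for e
  proof
    have er: "ennreal e \<le> ennreal r"
      using e by (simp add: ennreal_leI)
    show "nbhd X d B e \<subseteq> B"
    proof
      fix x assume "x \<in> nbhd X d B e"
      then obtain b where b: "x \<in> X" "b \<in> B" "b \<in> X" "d x b < ennreal e"
        using BX unfolding mem_nbhd_iff by blast
      then have bx: "d b x < ennreal r"
        using nonarch_sym[OF X b(1,3)] er by (simp add: less_le_trans)
      from B_cases show "x \<in> B"
      proof
        assume "B = {x\<in>X. d c x < ennreal r}"
        then show ?thesis
          using b bx nonarch_less[OF X c(1) b(3) b(1), of "ennreal r"] by simp
      next
        assume "B = {x\<in>X. d c x \<le> ennreal r}"
        then show ?thesis
          using b bx nonarch_le[OF X c(1) b(3) b(1), of "ennreal r"] by simp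
      qed
    qed
  qed (rule subset_nbhd[OF X BX e(1)])
  have large: "nbhd X d B e = {x\<in>X. d c x < ennreal e}" if e: "r < e" for e
  proof -
    have "ennreal r < ennreal e"
      using c e by (simp add: ennreal_lessI)
    then have cB_less: "d c b < ennreal e" if "b \<in> B" for b
      using that B_cases by (auto elim: less_trans le_less_trans)
    show ?thesis
    proof (intro set_eqI iffI)
      fix x assume "x \<in> nbhd X d B e"
      then obtain b where b: "x \<in> X" "b \<in> B" "b \<in> X" "d x b < ennreal e"
        using BX unfolding mem_nbhd_iff by blast
      then have "d b x < ennreal e"
        using nonarch_sym[OF X b(1,3)] by simp
      then show "x \<in> {x\<in>X. d c x < ennreal e}"
        using nonarch_less[OF X c(1) b(3,1) cB_less[OF b(2)]] b(1) by simp
    next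
      fix x assume "x \<in> {x\<in>X. d c x < ennreal e}"
      then show "x \<in> nbhd X d B e"
        using cB nonarch_sym[OF X c(1), of x] by (auto simp: mem_nbhd_iff)
    qed
  qed
  show ?thesis
    using c small large by (intro bexI[of _ c] exI[of _ r]) simp_all
qed

lemma nbhd_in_balls:
  assumes X: "nonarch_metric X d" and B: "B \<in> balls X d" and e: "0 < e"
  shows "nbhd X d B e \<in> balls X d"
proof -
  obtain c r where "c \<in> X" "0 < r"
    and small: "\<forall>e>0. e \<le> r \<longrightarrow> nbhd X d B e = B"
    and large: "\<forall>e>r. nbhd X d B e = {x\<in>X. d c x < ennreal e}"
    using nbhd_ball_cases[OF X B] by blast
  show ?thesis
  proof (cases "e \<le> r")
    case True
    then show ?thesis using small e B by simp
  next
    case False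
    then show ?thesis using large \<open>c \<in> X\<close> e unfolding balls_def by auto
  qed
qed

lemma nbhd_stable:
  assumes X: "nonarch_metric X d" and B: "B \<in> balls X d" and l: "0 < (l::real)"
  obtains r where "0 < r" "\<forall>e>0. e \<le> r \<longrightarrow> nbhd X d B (l * e) = B"
proof -
  obtain r where r: "0 < r" "\<forall>e>0. e \<le> r \<longrightarrow> nbhd X d B e = B"
    using nbhd_ball_cases[OF X B] by blast
  have "nbhd X d B (l * e) = B" if "0 < e" "e \<le> r / l" for e
    using r(2)[rule_format, of "l * e"] that l by (simp add: field_simps)
  then show ?thesis
    using that[of "r / l"] r l by simp
qed

lemma nbhd_scaled_nbhd:
  assumes "nonarch_metric X d" "B \<in> balls X d" "0 < (l::real)" "0 < e" "0 < f"
  shows "nbhd X d (nbhd X d B (l * e)) (l * f) = nbhd X d B (l * max e f)"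
  using nbhd_nbhd[OF assms(1) ball_subset[OF assms(2)], of "l * e" "l * f"] assms
  by (simp add: max_mult_distrib_left)

lemma hausdorff_nbhd_le:
  assumes X: "nonarch_metric X d" and B: "B \<in> balls X d" and e: "0 < e"
  shows "hausdorff_dist d B (nbhd X d B e) \<le> ennreal e"
proof -
  have "dist_to_set d a (nbhd X d B e) \<le> ennreal e" if "a \<in> B" for a
  proof -
    have "a \<in> X" "a \<in> nbhd X d B e"
      using ball_subset[OF B] subset_nbhd[OF X ball_subset[OF B] e] that by blast+
    then have "dist_to_set d a (nbhd X d B e) < ennreal e"
      using nonarch_refl[OF X, of a] e by (auto simp: dist_to_set_less_iff intro!: bexI[of _ a])
    then show ?thesis by simp
  qed
  moreover have "dist_to_set d a B \<le> ennreal e" if "a \<in> nbhd X d B e" for a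
    using that by (auto simp: nbhd_def)
  ultimately show ?thesis
    by (auto simp: hausdorff_dist_def intro!: SUP_least)
qed

lemma hausdorff_lessD:
  assumes "hausdorff_dist d A B < c"
  shows "\<And>a. a \<in> A \<Longrightarrow> \<exists>b\<in>B. d a b < c" and "\<And>b. b \<in> B \<Longrightarrow> \<exists>a\<in>A. d b a < c"
proof -
  have "(SUP a\<in>A. dist_to_set d a B) < c" "(SUP b\<in>B. dist_to_set d b A) < c"
    using assms by (simp_all add: hausdorff_dist_def)
  from this[THEN SUP_lessD] show "\<And>a. a \<in> A \<Longrightarrow> \<exists>b\<in>B. d a b < c" and "\<And>b. b \<in> B \<Longrightarrow> \<exists>a\<in>A. d b a < c"
    by (simp_all add: dist_to_set_less_iff)
qed

text \<open>
  Each of the sets lies in the \<open>e\<close>-fattening of the other, and a second fattening by \<open>e\<close> adds nothing.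
\<close>

lemma nbhd_eq_if_hausdorff_less:
  assumes X: "nonarch_metric X d" and A: "A \<subseteq> X" and B: "B \<subseteq> X"
    and H: "hausdorff_dist d A B < ennreal e"
  shows "nbhd X d A e = nbhd X d B e"
proof -
  have "nbhd X d A e \<subseteq> nbhd X d B e"
    if sub: "A \<subseteq> X" "B \<subseteq> X" and close: "\<And>a. a \<in> A \<Longrightarrow> \<exists>b\<in>B. d a b < ennreal e" for A B
  proof
    fix x assume "x \<in> nbhd X d A e"
    then obtain a where a: "x \<in> X" "a \<in> A" "d x a < ennreal e"
      unfolding mem_nbhd_iff by blast
    obtain b where b: "b \<in> B" "d a b < ennreal e"
      using close[OF a(2)] by blast
    have "d x b < ennreal e"
      using nonarch_less[OF X a(1) subsetD[OF sub(1) a(2)] subsetD[OF sub(2) b(1)] a(3) b(2)] .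
    then show "x \<in> nbhd X d B e"
      using a b unfolding mem_nbhd_iff by blast
  qed
  from this[OF A B hausdorff_lessD(1)[OF H]] this[OF B A hausdorff_lessD(2)[OF H]]
  show ?thesis by (rule subset_antisym)
qed

section \<open>The distances on maps of balls\<close>

text \<open>
  The conditions on the parameter are named so that both distances become instances of \<open>adm_inf\<close>
  and their triangle inequalities follow from one lemma.
\<close>

definition beta_adm where
  "beta_adm l X dX dY P1 P2 \<epsilon> \<longleftrightarrow> (\<forall>B\<in>balls X dX.
     dY (P1 B) (P2 (nbhd X dX B (l * \<epsilon>))) \<le> ennreal \<epsilon> \<and>
     dY (P2 B) (P1 (nbhd X dX B (l * \<epsilon>))) \<le> ennreal \<epsilon>)"

definition beta_star_adm where
  "beta_star_adm l X dX dY P1 P2 \<epsilon> \<longleftrightarrow> (\<forall>B\<in>balls X dX. \<exists>\<epsilon>1 \<epsilon>2.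
     0 < \<epsilon>1 \<and> \<epsilon>1 \<le> \<epsilon> \<and> 0 < \<epsilon>2 \<and> \<epsilon>2 \<le> \<epsilon> \<and>
     dY (P1 B) (P2 (nbhd X dX B (l * \<epsilon>1))) \<le> ennreal \<epsilon> \<and>
     dY (P2 B) (P1 (nbhd X dX B (l * \<epsilon>2))) \<le> ennreal \<epsilon>)"

lemma beta_eq_adm_inf:
  "beta l X dX dY P1 P2 = (if P1 = P2 then 0 else adm_inf (beta_adm l X dX dY P1 P2))"
  by (simp add: beta_def adm_inf_def beta_adm_def)

lemma beta_star_eq_adm_inf:
  "beta_star l X dX dY P1 P2 = adm_inf (beta_star_adm l X dX dY P1 P2)"
  by (simp add: beta_star_def adm_inf_def beta_star_adm_def)

lemma ball_maps_mem: "P \<in> ball_maps X dX Y \<Longrightarrow> B \<in> balls X dX \<Longrightarrow> P B \<in> Y"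
  by (auto simp: ball_maps_def)

lemma ball_maps_eqI:
  assumes "P1 \<in> ball_maps X dX Y" "P2 \<in> ball_maps X dX Y"
    and "\<And>B. B \<in> balls X dX \<Longrightarrow> P1 B = P2 B"
  shows "P1 = P2"
  using assms unfolding ball_maps_def by (rule PiE_ext)

lemma beta_sym: "beta l X dX dY P1 P2 = beta l X dX dY P2 P1"
proof -
  have "beta_adm l X dX dY P1 P2 = beta_adm l X dX dY P2 P1"
    unfolding beta_adm_def by (auto simp: fun_eq_iff)
  then show ?thesis
    by (auto simp: beta_eq_adm_inf)
qed

lemma beta_star_sym: "beta_star l X dX dY P1 P2 = beta_star l X dX dY P2 P1"
proof -
  have "beta_star_adm l X dX dY P1 P2 = beta_star_adm l X dX dY P2 P1"
    unfolding beta_star_adm_def by (intro ext ball_cong refl) blast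
  then show ?thesis
    by (simp add: beta_star_eq_adm_inf)
qed

lemma rho_s_lessD:
  assumes "rho_s X dX dY P1 P2 < c" "B \<in> balls X dX"
  shows "dY (P1 B) (P2 B) < c"
  using assms unfolding rho_s_def by (rule SUP_lessD)

lemma dist_to_graph_lessD:
  assumes "dist_to_set (max_dist (hausdorff_dist dX) dY) (B, y) (ball_graph X dX P) < c"
  obtains B' where "B' \<in> balls X dX" "hausdorff_dist dX B B' < c" "dY y (P B') < c"
  using assms unfolding dist_to_set_less_iff ball_graph_def max_dist_def by auto

lemma dist_to_graph_leI:
  assumes "B' \<in> balls X dX" "hausdorff_dist dX B B' \<le> c" "dY y (P B') \<le> c"
  shows "dist_to_set (max_dist (hausdorff_dist dX) dY) (B, y) (ball_graph X dX P) \<le> c"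
proof -
  have "dist_to_set (max_dist (hausdorff_dist dX) dY) (B, y) (ball_graph X dX P)
      \<le> max_dist (hausdorff_dist dX) dY (B, y) (B', P B')"
    unfolding dist_to_set_def by (rule INF_lower) (use assms(1) in \<open>auto simp: ball_graph_def\<close>)
  also have "\<dots> \<le> c"
    using assms by (simp add: max_dist_def)
  finally show ?thesis .
qed

locale nonarch_pair =
  fixes X :: "'a set" and dX :: "'a \<Rightarrow> 'a \<Rightarrow> ennreal"
    and Y :: "'b set" and dY :: "'b \<Rightarrow> 'b \<Rightarrow> ennreal"
  assumes X: "nonarch_metric X dX" and Y: "nonarch_metric Y dY"
begin

abbreviation fat :: "'a set \<Rightarrow> real \<Rightarrow> 'a set" where
  "fat \<equiv> nbhd X dX"

text \<open>
  An admissible parameter below the stability radius of \<open>B\<close> compares the two maps at \<open>B\<close> itself.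
\<close>

lemma eq_if_beta_star_zero:
  assumes l: "0 < l" and P: "P1 \<in> ball_maps X dX Y" "P2 \<in> ball_maps X dX Y"
    and zero: "beta_star l X dX dY P1 P2 = 0"
  shows "P1 = P2"
proof (rule ball_maps_eqI[OF P])
  fix B assume B: "B \<in> balls X dX"
  obtain r where r: "0 < r" "\<forall>e>0. e \<le> r \<longrightarrow> fat B (l * e) = B"
    by (rule nbhd_stable[OF X B l])
  have "dY (P1 B) (P2 B) \<le> 0"
  proof (rule ennreal_le_if_real_bounds)
    fix c :: real assume c: "0 < c"
    then have "adm_inf (beta_star_adm l X dX dY P1 P2) < ennreal (min c r)"
      using zero r(1) by (simp add: beta_star_eq_adm_inf)
    then obtain e where e: "0 < e" "beta_star_adm l X dX dY P1 P2 e" "ennreal e < ennreal (min c r)"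
      by (rule adm_inf_lessE)
    then have ecr: "e < c" "e < r"
      by (auto simp: ennreal_less_iff)
    obtain f where f: "0 < f" "f \<le> e" "dY (P1 B) (P2 (fat B (l * f))) \<le> ennreal e"
      using e(2) B unfolding beta_star_adm_def by blast
    have "fat B (l * f) = B"
      using r(2) f ecr by simp
    then have "dY (P1 B) (P2 B) \<le> ennreal e"
      using f(3) by simp
    also have "\<dots> \<le> ennreal c"
      using ecr by (simp add: ennreal_leI)
    finally show "dY (P1 B) (P2 B) \<le> ennreal c" .
  qed
  then show "P1 B = P2 B"
    using Y ball_maps_mem[OF P(1) B] ball_maps_mem[OF P(2) B] by (simp add: nonarch_metric_def)
qed

text \<open>
  For \<open>\<beta>\<^sup>*\<close> the fattening may be chosen below the stability radius of each ball separately, so that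
  it compares the maps at \<open>B\<close>, as \<open>\<rho>\<^sub>s\<close> does.
\<close>

lemma beta_star_le_rho_s:
  assumes l: "0 < l" and P: "P1 \<in> ball_maps X dX Y" "P2 \<in> ball_maps X dX Y"
  shows "beta_star l X dX dY P1 P2 \<le> rho_s X dX dY P1 P2"
proof (rule ennreal_le_if_real_bounds)
  fix c :: real assume c: "0 < c" "rho_s X dX dY P1 P2 < ennreal c"
  have "beta_star_adm l X dX dY P1 P2 c"
    unfolding beta_star_adm_def
  proof
    fix B assume B: "B \<in> balls X dX"
    obtain r where r: "0 < r" "\<forall>e>0. e \<le> r \<longrightarrow> fat B (l * e) = B"
      by (rule nbhd_stable[OF X B l])
    have fix_B: "fat B (l * min r c) = B"
      using r c by simp
    have d: "dY (P1 B) (P2 B) \<le> ennreal c"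
      using rho_s_lessD[OF c(2) B] by simp
    moreover have "dY (P2 B) (P1 B) \<le> ennreal c"
      using d nonarch_sym[OF Y ball_maps_mem[OF P(1) B] ball_maps_mem[OF P(2) B]] by simp
    ultimately show "\<exists>\<epsilon>1 \<epsilon>2. 0 < \<epsilon>1 \<and> \<epsilon>1 \<le> c \<and> 0 < \<epsilon>2 \<and> \<epsilon>2 \<le> c \<and>
        dY (P1 B) (P2 (fat B (l * \<epsilon>1))) \<le> ennreal c \<and> dY (P2 B) (P1 (fat B (l * \<epsilon>2))) \<le> ennreal c"
      using fix_B r(1) c(1) by (intro exI[of _ "min r c"]) simp
  qed
  then show "beta_star l X dX dY P1 P2 \<le> ennreal c"
    using c(1) by (simp add: beta_star_eq_adm_inf adm_inf_le)
qed

text \<open>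
  With \<open>C = fat B (l * e)\<close>, the ball \<open>C\<close> is its own fattening, so an admissible \<open>e\<close> bounds each step
  of the chain \<open>P1 B, P2 C, P1 C, P2 B\<close>.
\<close>

lemma rho_s_le_beta:
  assumes l: "0 < l" and P: "P1 \<in> ball_maps X dX Y" "P2 \<in> ball_maps X dX Y"
  shows "rho_s X dX dY P1 P2 \<le> beta l X dX dY P1 P2"
  unfolding rho_s_def
proof (rule SUP_least)
  fix B assume B: "B \<in> balls X dX"
  note mem = ball_maps_mem[OF P(1)] ball_maps_mem[OF P(2)]
  show "dY (P1 B) (P2 B) \<le> beta l X dX dY P1 P2"
  proof (cases "P1 = P2")
    case True
    then show ?thesis
      using nonarch_refl[OF Y mem(2)[OF B]] by simp
  next
    case False
    have "dY (P1 B) (P2 B) \<le> ennreal e" if e: "0 < e" "beta_adm l X dX dY P1 P2 e" for e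
    proof -
      define C where "C = fat B (l * e)"
      have C: "C \<in> balls X dX"
        unfolding C_def using nbhd_in_balls[OF X B] l e by simp
      have CC: "fat C (l * e) = C"
        unfolding C_def using nbhd_scaled_nbhd[OF X B l e(1) e(1)] by simp
      have 1: "dY (P1 B) (P2 C) \<le> ennreal e" and 3: "dY (P2 B) (P1 C) \<le> ennreal e"
        using e(2) B unfolding beta_adm_def C_def by auto
      have 2: "dY (P2 C) (P1 C) \<le> ennreal e"
        using e(2) C CC unfolding beta_adm_def by auto
      have 4: "dY (P1 C) (P2 B) \<le> ennreal e"
        using 3 nonarch_sym[OF Y mem(1)[OF C] mem(2)[OF B]] by simp
      have "dY (P1 B) (P1 C) \<le> ennreal e"
        using nonarch_le[OF Y mem(1)[OF B] mem(2)[OF C] mem(1)[OF C] 1 2] .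
      from nonarch_le[OF Y mem(1)[OF B] mem(1)[OF C] mem(2)[OF B] this 4] show ?thesis .
    qed
    then show ?thesis
      using False by (simp add: beta_eq_adm_inf adm_inf_geI)
  qed
qed

lemma rho_H_le_beta_star:
  assumes l: "0 < l"
  shows "rho_H X dX dY P1 P2 \<le> ennreal (max 1 l) * beta_star l X dX dY P1 P2"
proof -
  have adm: "rho_H X dX dY P1 P2 \<le> ennreal (max 1 l * e)"
    if e: "0 < e" "beta_star_adm l X dX dY P1 P2 e" for e
  proof -
    have near: "dist_to_set (max_dist (hausdorff_dist dX) dY) (B, y) (ball_graph X dX Q)
        \<le> ennreal (max 1 l * e)"
      if B: "B \<in> balls X dX" and f: "0 < f" "f \<le> e" "dY y (Q (fat B (l * f))) \<le> ennreal e"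
      for B y Q f
    proof (rule dist_to_graph_leI)
      show "fat B (l * f) \<in> balls X dX"
        using nbhd_in_balls[OF X B] l f by simp
      have "l * f \<le> max 1 l * e"
        using l f by (intro mult_mono) auto
      then show "hausdorff_dist dX B (fat B (l * f)) \<le> ennreal (max 1 l * e)"
        using hausdorff_nbhd_le[OF X B, of "l * f"] l f
        by (auto intro: order_trans[OF _ ennreal_leI])
      have "1 * e \<le> max 1 l * e"
        using e(1) by (intro mult_right_mono) auto
      then show "dY y (Q (fat B (l * f))) \<le> ennreal (max 1 l * e)"
        using f(3) by (auto intro: order_trans[OF _ ennreal_leI])
    qed
    show ?thesis
      unfolding rho_H_def hausdorff_dist_def[of "max_dist _ _"]
    proof (intro max.boundedI SUP_least)
      fix p assume "p \<in> ball_graph X dX P1"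
      then obtain B where "B \<in> balls X dX" "p = (B, P1 B)"
        unfolding ball_graph_def by blast
      then show "dist_to_set (max_dist (hausdorff_dist dX) dY) p (ball_graph X dX P2)
          \<le> ennreal (max 1 l * e)"
        using near e(2) unfolding beta_star_adm_def by blast
    next
      fix p assume "p \<in> ball_graph X dX P2"
      then obtain B where "B \<in> balls X dX" "p = (B, P2 B)"
        unfolding ball_graph_def by blast
      then show "dist_to_set (max_dist (hausdorff_dist dX) dY) p (ball_graph X dX P1)
          \<le> ennreal (max 1 l * e)"
        using near e(2) unfolding beta_star_adm_def by blast
    qed
  qed
  \<comment> \<open>Dividing by the positive finite constant turns the bound for each admissible parameter into one
      for their infimum.\<close>
  define m where "m = max 1 l"
  have m: "0 < m" by (simp add: m_def)
  have "ennreal (1 / m) * rho_H X dX dY P1 P2 \<le> beta_star l X dX dY P1 P2"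
    unfolding beta_star_eq_adm_inf
  proof (rule adm_inf_geI)
    fix e :: real assume "0 < e" "beta_star_adm l X dX dY P1 P2 e"
    then have "ennreal (1 / m) * rho_H X dX dY P1 P2 \<le> ennreal (1 / m) * ennreal (m * e)"
      using adm unfolding m_def by (intro mult_left_mono) auto
    also have "\<dots> = ennreal e"
      using m \<open>0 < e\<close> by (simp flip: ennreal_mult)
    finally show "ennreal (1 / m) * rho_H X dX dY P1 P2 \<le> ennreal e" .
  qed
  then have "ennreal m * (ennreal (1 / m) * rho_H X dX dY P1 P2) \<le> ennreal m * beta_star l X dX dY P1 P2"
    by (intro mult_left_mono) auto
  moreover have "ennreal m * (ennreal (1 / m) * rho_H X dX dY P1 P2) = rho_H X dX dY P1 P2"
    using m by (simp add: mult.assoc[symmetric] flip: ennreal_mult)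
  ultimately show ?thesis
    by (simp add: m_def)
qed

text \<open>
  A step from \<open>B\<close> to \<open>fat B (l * e)\<close> followed by a fattening by \<open>l * f\<close> ends at the fattening of \<open>B\<close>
  by \<open>l * max e f\<close>, which is exactly the ball that the parameter \<open>max e f\<close> asks for.
\<close>

lemma beta_triangle:
  assumes l: "0 < l" and P: "P1 \<in> ball_maps X dX Y" "P2 \<in> ball_maps X dX Y" "P3 \<in> ball_maps X dX Y"
  shows "beta l X dX dY P1 P3 \<le> max (beta l X dX dY P1 P2) (beta l X dX dY P2 P3)"
  \<comment> \<open>Coinciding maps are set apart: their distance is \<open>0\<close> by convention, whereas a map that varies
      under fattening may have no small admissible parameter with respect to itself.\<close>
proof (cases "P1 = P2 \<or> P2 = P3 \<or> P1 = P3")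
  case True
  then show ?thesis by (auto simp: beta_def)
next
  case False
  have chain: "dY (Q B) (S (fat B (l * max e f))) \<le> ennreal (max e f)"
    if Q: "Q \<in> ball_maps X dX Y" and R: "R \<in> ball_maps X dX Y" and S: "S \<in> ball_maps X dX Y"
      and e: "0 < e" "beta_adm l X dX dY Q R e" and f: "0 < f" "beta_adm l X dX dY R S f"
      and B: "B \<in> balls X dX"
    for Q R S B e f
  proof -
    let ?C = "fat B (l * e)" and ?D = "fat B (l * max e f)"
    have C: "?C \<in> balls X dX" and D: "?D \<in> balls X dX"
      using nbhd_in_balls[OF X B] l e by simp_all
    have "dY (Q B) (R ?C) \<le> ennreal e"
      using e(2) B unfolding beta_adm_def by auto
    then have 1: "dY (Q B) (R ?C) \<le> ennreal (max e f)"
      by (rule order_trans) (simp add: ennreal_leI)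
    have "dY (R ?C) (S ?D) \<le> ennreal f"
      using f(2) C nbhd_scaled_nbhd[OF X B l e(1) f(1)] unfolding beta_adm_def by auto
    then have 2: "dY (R ?C) (S ?D) \<le> ennreal (max e f)"
      by (rule order_trans) (simp add: ennreal_leI)
    show ?thesis
      using nonarch_le[OF Y ball_maps_mem[OF Q B] ball_maps_mem[OF R C] ball_maps_mem[OF S D] 1 2] .
  qed
  have adm_sym: "beta_adm l X dX dY Q R e \<Longrightarrow> beta_adm l X dX dY R Q e" for Q R e
    unfolding beta_adm_def by blast
  have "adm_inf (beta_adm l X dX dY P1 P3)
      \<le> max (adm_inf (beta_adm l X dX dY P1 P2)) (adm_inf (beta_adm l X dX dY P2 P3))"
  proof (rule adm_inf_triangle)
    fix e f :: real
    assume e: "0 < e" "beta_adm l X dX dY P1 P2 e" and f: "0 < f" "beta_adm l X dX dY P2 P3 f"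
    show "beta_adm l X dX dY P1 P3 (max e f)"
      unfolding beta_adm_def
      using chain[OF P e f] chain[OF P(3,2,1) f(1) adm_sym[OF f(2)] e(1) adm_sym[OF e(2)]]
      by (simp add: max.commute)
  qed
  then show ?thesis
    using False by (simp add: beta_eq_adm_inf)
qed

text \<open>
  The second step of the chain uses the parameter that belongs to the fattened ball, not to \<open>B\<close>;
  both parameters stay below the common bound, and hence so does their maximum.
\<close>

lemma beta_star_triangle:
  assumes l: "0 < l" and P: "P1 \<in> ball_maps X dX Y" "P2 \<in> ball_maps X dX Y" "P3 \<in> ball_maps X dX Y"
  shows "beta_star l X dX dY P1 P3 \<le> max (beta_star l X dX dY P1 P2) (beta_star l X dX dY P2 P3)"
proof -
  have chain: "\<exists>g. 0 < g \<and> g \<le> max e f \<and> dY (Q B) (S (fat B (l * g))) \<le> ennreal (max e f)"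
    if Q: "Q \<in> ball_maps X dX Y" and R: "R \<in> ball_maps X dX Y" and S: "S \<in> ball_maps X dX Y"
      and e: "beta_star_adm l X dX dY Q R e" and f: "beta_star_adm l X dX dY R S f"
      and B: "B \<in> balls X dX"
    for Q R S B e f
  proof -
    obtain e1 where e1: "0 < e1" "e1 \<le> e" "dY (Q B) (R (fat B (l * e1))) \<le> ennreal e"
      using e B unfolding beta_star_adm_def by blast
    let ?C = "fat B (l * e1)"
    have C: "?C \<in> balls X dX"
      using nbhd_in_balls[OF X B] l e1 by simp
    obtain f1 where f1: "0 < f1" "f1 \<le> f" "dY (R ?C) (S (fat ?C (l * f1))) \<le> ennreal f"
      using f C unfolding beta_star_adm_def by blast
    let ?D = "fat B (l * max e1 f1)"
    have D: "?D \<in> balls X dX"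
      using nbhd_in_balls[OF X B] l e1 by simp
    have 1: "dY (Q B) (R ?C) \<le> ennreal (max e f)"
      using e1(3) by (rule order_trans) (simp add: ennreal_leI)
    have "dY (R ?C) (S ?D) \<le> ennreal f"
      using f1(3) nbhd_scaled_nbhd[OF X B l e1(1) f1(1)] by simp
    then have 2: "dY (R ?C) (S ?D) \<le> ennreal (max e f)"
      by (rule order_trans) (simp add: ennreal_leI)
    have "dY (Q B) (S ?D) \<le> ennreal (max e f)"
      using nonarch_le[OF Y ball_maps_mem[OF Q B] ball_maps_mem[OF R C] ball_maps_mem[OF S D] 1 2] .
    then show ?thesis
      using e1 f1 by (intro exI[of _ "max e1 f1"]) auto
  qed
  have adm_sym: "beta_star_adm l X dX dY Q R e \<Longrightarrow> beta_star_adm l X dX dY R Q e" for Q R e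
    unfolding beta_star_adm_def by blast
  show ?thesis
    unfolding beta_star_eq_adm_inf
  proof (rule adm_inf_triangle)
    fix e f :: real
    assume e: "beta_star_adm l X dX dY P1 P2 e" and f: "beta_star_adm l X dX dY P2 P3 f"
    show "beta_star_adm l X dX dY P1 P3 (max e f)"
      unfolding beta_star_adm_def
    proof
      fix B assume B: "B \<in> balls X dX"
      obtain g where "0 < g" "g \<le> max e f" "dY (P1 B) (P3 (fat B (l * g))) \<le> ennreal (max e f)"
        using chain[OF P e f B] by blast
      moreover obtain h where "0 < h" "h \<le> max e f"
        "dY (P3 B) (P1 (fat B (l * h))) \<le> ennreal (max e f)"
        using chain[OF P(3,2,1) adm_sym[OF f] adm_sym[OF e] B] by (metis max.commute)
      ultimately show "\<exists>\<epsilon>1 \<epsilon>2. 0 < \<epsilon>1 \<and> \<epsilon>1 \<le> max e f \<and> 0 < \<epsilon>2 \<and> \<epsilon>2 \<le> max e f \<and>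
          dY (P1 B) (P3 (fat B (l * \<epsilon>1))) \<le> ennreal (max e f) \<and>
          dY (P3 B) (P1 (fat B (l * \<epsilon>2))) \<le> ennreal (max e f)"
        by blast
    qed
  qed
qed

lemma rho_s_refl:
  assumes "P \<in> ball_maps X dX Y"
  shows "rho_s X dX dY P P = 0"
proof -
  have "rho_s X dX dY P P \<le> 0"
    unfolding rho_s_def
    by (rule SUP_least) (simp add: nonarch_refl[OF Y ball_maps_mem[OF assms]])
  then show ?thesis by simp
qed

lemma beta_star_nonarch:
  assumes l: "0 < l"
  shows "nonarch_metric (ball_maps X dX Y) (beta_star l X dX dY)"
proof -
  have "beta_star l X dX dY P P = 0" if "P \<in> ball_maps X dX Y" for P
    using beta_star_le_rho_s[OF l that that] rho_s_refl[OF that] by simp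
  then show ?thesis
    unfolding nonarch_metric_def
    using eq_if_beta_star_zero[OF l] beta_star_triangle[OF l] by (auto intro: beta_star_sym)
qed

text \<open>Separation is inherited from the smaller distance \<open>\<beta>\<^sup>*\<close>.\<close>

lemma beta_nonarch:
  assumes l: "0 < l"
  shows "nonarch_metric (ball_maps X dX Y) (beta l X dX dY)"
proof -
  have "P1 = P2"
    if P: "P1 \<in> ball_maps X dX Y" "P2 \<in> ball_maps X dX Y" and zero: "beta l X dX dY P1 P2 = 0"
    for P1 P2
  proof (rule eq_if_beta_star_zero[OF l P])
    have "beta_star l X dX dY P1 P2 \<le> beta l X dX dY P1 P2"
      using beta_star_le_rho_s[OF l P] rho_s_le_beta[OF l P] by (rule order_trans)
    then show "beta_star l X dX dY P1 P2 = 0"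
      using zero by simp
  qed
  moreover have "beta l X dX dY P P = 0" for P
    by (simp add: beta_def)
  ultimately show ?thesis
    unfolding nonarch_metric_def
    using beta_triangle[OF l] by (auto intro: beta_sym)
qed

section \<open>Lipschitz maps and uniform convergence\<close>

lemma lip_ball_maps_mem: "P \<in> lip_ball_maps l X dX Y dY \<Longrightarrow> P \<in> ball_maps X dX Y"
  by (simp add: lip_ball_maps_def)

lemma lip_ball_mapsD:
  assumes "P \<in> lip_ball_maps l X dX Y dY" "0 < e" "B \<in> balls X dX"
  shows "dY (P B) (P (fat B (l * e))) \<le> ennreal e"
  using assms by (simp add: lip_ball_maps_def)

text \<open>
  The graph point near \<open>(B, P B)\<close> sits over a ball with the same fattening as \<open>B\<close>, and the Lipschitz
  property carries its value over to that common fattening.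
\<close>

lemma dist_le_if_near_graph:
  assumes P: "P \<in> ball_maps X dX Y" and Q: "Q \<in> lip_ball_maps 1 X dX Y dY"
    and B: "B \<in> balls X dX" and e: "0 < e"
    and near: "dist_to_set (max_dist (hausdorff_dist dX) dY) (B, P B) (ball_graph X dX Q) < ennreal e"
  shows "dY (P B) (Q (fat B e)) \<le> ennreal e"
proof -
  obtain B' where B': "B' \<in> balls X dX" "hausdorff_dist dX B B' < ennreal e"
    "dY (P B) (Q B') < ennreal e"
    using dist_to_graph_lessD[OF near] .
  have "fat B e = fat B' e"
    using nbhd_eq_if_hausdorff_less[OF X ball_subset[OF B] ball_subset[OF B'(1)] B'(2)] .
  then have "dY (Q B') (Q (fat B e)) \<le> ennreal e"
    using lip_ball_mapsD[OF Q e B'(1)] by simp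
  then show ?thesis
    using nonarch_le[OF Y ball_maps_mem[OF P B] ball_maps_mem[OF lip_ball_maps_mem[OF Q] B'(1)]
        ball_maps_mem[OF lip_ball_maps_mem[OF Q] nbhd_in_balls[OF X B e]]] B'(3)
    by simp
qed

lemma beta_le_rho_H:
  assumes P: "P1 \<in> lip_ball_maps 1 X dX Y dY" "P2 \<in> lip_ball_maps 1 X dX Y dY"
  shows "beta 1 X dX dY P1 P2 \<le> rho_H X dX dY P1 P2"
proof (rule ennreal_le_if_real_bounds)
  fix e :: real assume e: "0 < e" and rho: "rho_H X dX dY P1 P2 < ennreal e"
  let ?d = "max_dist (hausdorff_dist dX) dY"
  have "(SUP p\<in>ball_graph X dX P1. dist_to_set ?d p (ball_graph X dX P2)) < ennreal e"
    and "(SUP p\<in>ball_graph X dX P2. dist_to_set ?d p (ball_graph X dX P1)) < ennreal e"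
    using rho by (simp_all add: rho_H_def hausdorff_dist_def[of ?d])
  moreover have "(B, P B) \<in> ball_graph X dX P" if "B \<in> balls X dX" for B and P :: "'a set \<Rightarrow> 'b"
    using that unfolding ball_graph_def by blast
  ultimately have
    "dist_to_set ?d (B, P1 B) (ball_graph X dX P2) < ennreal e \<and>
     dist_to_set ?d (B, P2 B) (ball_graph X dX P1) < ennreal e" if "B \<in> balls X dX" for B
    using that by (auto dest: SUP_lessD)
  then have "beta_adm 1 X dX dY P1 P2 e"
    unfolding beta_adm_def
    using dist_le_if_near_graph[OF lip_ball_maps_mem[OF P(1)] P(2) _ e]
      dist_le_if_near_graph[OF lip_ball_maps_mem[OF P(2)] P(1) _ e] by simp
  then show "beta 1 X dX dY P1 P2 \<le> ennreal e"
    using e by (simp add: beta_eq_adm_inf adm_inf_le)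
qed

lemma distances_eq_on_lip_ball_maps:
  assumes P: "P1 \<in> lip_ball_maps 1 X dX Y dY" "P2 \<in> lip_ball_maps 1 X dX Y dY"
  shows "rho_H X dX dY P1 P2 = rho_s X dX dY P1 P2 \<and>
    rho_s X dX dY P1 P2 = beta 1 X dX dY P1 P2 \<and>
    beta 1 X dX dY P1 P2 = beta_star 1 X dX dY P1 P2"
proof -
  note mem = lip_ball_maps_mem[OF P(1)] lip_ball_maps_mem[OF P(2)]
  have "rho_H X dX dY P1 P2 \<le> beta_star 1 X dX dY P1 P2"
    using rho_H_le_beta_star[of 1 P1 P2] by simp
  moreover have "beta_star 1 X dX dY P1 P2 \<le> rho_s X dX dY P1 P2"
    using beta_star_le_rho_s[OF _ mem] by simp
  moreover have "rho_s X dX dY P1 P2 \<le> beta 1 X dX dY P1 P2"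
    using rho_s_le_beta[OF _ mem] by simp
  ultimately show ?thesis
    using beta_le_rho_H[OF P] by auto
qed

text \<open>
  Passing from \<open>B\<close> to its fattening costs at most \<open>e\<close> when it is done inside the Lipschitz map.
\<close>

lemma beta_eq_rho_s_if_lip:
  assumes Q: "Q \<in> ball_maps X dX Y" and P: "P \<in> lip_ball_maps 1 X dX Y dY"
  shows "beta 1 X dX dY Q P = rho_s X dX dY Q P"
proof (rule antisym)
  note P' = lip_ball_maps_mem[OF P]
  show "beta 1 X dX dY Q P \<le> rho_s X dX dY Q P"
  proof (rule ennreal_le_if_real_bounds)
    fix e :: real assume e: "0 < e" and rho: "rho_s X dX dY Q P < ennreal e"
    have "beta_adm 1 X dX dY Q P e"
      unfolding beta_adm_def
    proof
      fix B assume B: "B \<in> balls X dX"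
      let ?C = "fat B (1 * e)"
      have C: "?C \<in> balls X dX"
        using nbhd_in_balls[OF X B e] by simp
      note QB = ball_maps_mem[OF Q B] and QC = ball_maps_mem[OF Q C]
        and PB = ball_maps_mem[OF P' B] and PC = ball_maps_mem[OF P' C]
      have 1: "dY (P B) (P ?C) \<le> ennreal e"
        using lip_ball_mapsD[OF P e B] .
      have 2: "dY (Q B) (P B) \<le> ennreal e"
        using rho_s_lessD[OF rho B] by simp
      have "dY (Q ?C) (P ?C) \<le> ennreal e"
        using rho_s_lessD[OF rho C] by simp
      then have 3: "dY (P ?C) (Q ?C) \<le> ennreal e"
        using nonarch_sym[OF Y QC PC] by simp
      show "dY (Q B) (P ?C) \<le> ennreal e \<and> dY (P B) (Q ?C) \<le> ennreal e"
        using nonarch_le[OF Y QB PB PC 2 1] nonarch_le[OF Y PB PC QC 1 3] by blast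
    qed
    then show "beta 1 X dX dY Q P \<le> ennreal e"
      using e by (simp add: beta_eq_adm_inf adm_inf_le)
  qed
  show "rho_s X dX dY Q P \<le> beta 1 X dX dY Q P"
    using rho_s_le_beta[OF _ Q P'] by simp
qed

lemma beta_tendsto_iff_uniform:
  assumes P: "P \<in> lip_ball_maps 1 X dX Y dY"
    and Pn: "\<forall>n\<ge>1. (Pn :: nat \<Rightarrow> 'a set \<Rightarrow> 'b) n \<in> ball_maps X dX Y"
  shows "((\<lambda>n. beta 1 X dX dY (Pn n) P) \<longlonglongrightarrow> 0) \<longleftrightarrow>
    ((\<lambda>n. SUP B\<in>balls X dX. dY (Pn n B) (P B)) \<longlonglongrightarrow> 0)"
proof (rule tendsto_cong)
  show "\<forall>\<^sub>F n in sequentially.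
      beta 1 X dX dY (Pn n) P = (SUP B\<in>balls X dX. dY (Pn n B) (P B))"
    using eventually_ge_at_top[of 1]
  proof eventually_elim
    case (elim n)
    then show ?case
      using beta_eq_rho_s_if_lip[OF _ P] Pn by (simp add: rho_s_def)
  qed
qed

end

theorem theorem4p2:
  fixes X :: "'a set" and dX :: "'a \<Rightarrow> 'a \<Rightarrow> ennreal"
    and Y :: "'b set" and dY :: "'b \<Rightarrow> 'b \<Rightarrow> ennreal"
  assumes "nonarch_metric X dX" and "nonarch_metric Y dY"
    and "\<forall>B\<in>balls X dX. \<exists>x\<in>B. \<exists>y\<in>B. x \<noteq> y"
    and "\<forall>B\<in>balls Y dY. \<exists>x\<in>B. \<exists>y\<in>B. x \<noteq> y"
  shows "(\<forall>l::real. 0 < l \<longrightarrow>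
            nonarch_metric (ball_maps X dX Y) (beta l X dX dY) \<and>
            nonarch_metric (ball_maps X dX Y) (beta_star l X dX dY))
       \<and> (\<forall>l::real. 0 < l \<longrightarrow> (\<forall>P1\<in>ball_maps X dX Y. \<forall>P2\<in>ball_maps X dX Y.
            beta_star l X dX dY P1 P2 \<le> rho_s X dX dY P1 P2 \<and>
            rho_s X dX dY P1 P2 \<le> beta l X dX dY P1 P2 \<and>
            rho_H X dX dY P1 P2 \<le> ennreal (max 1 l) * beta_star l X dX dY P1 P2))
       \<and> (\<forall>P1\<in>lip_ball_maps 1 X dX Y dY. \<forall>P2\<in>lip_ball_maps 1 X dX Y dY.
            rho_H X dX dY P1 P2 = rho_s X dX dY P1 P2 \<and>
            rho_s X dX dY P1 P2 = beta 1 X dX dY P1 P2 \<and>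
            beta 1 X dX dY P1 P2 = beta_star 1 X dX dY P1 P2)
       \<and> (\<forall>P\<in>lip_ball_maps 1 X dX Y dY. \<forall>Pn :: nat \<Rightarrow> 'a set \<Rightarrow> 'b.
            (\<forall>n\<ge>1. Pn n \<in> ball_maps X dX Y) \<longrightarrow>
            (((\<lambda>n. beta 1 X dX dY (Pn n) P) \<longlonglongrightarrow> 0) \<longleftrightarrow>
             ((\<lambda>n. SUP B\<in>balls X dX. dY (Pn n B) (P B)) \<longlonglongrightarrow> 0)))"
proof -
  interpret nonarch_pair X dX Y dY
    using assms(1,2) by unfold_locales
  show ?thesis
    using beta_nonarch beta_star_nonarch beta_star_le_rho_s rho_s_le_beta rho_H_le_beta_star
      distances_eq_on_lip_ball_maps beta_tendsto_iff_uniform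
    by (intro conjI allI ballI impI) blast+
qed

end
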